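(* There are universal constants $\varepsilon_0>0$, $c>0$ and $0<a\le b$ such that for every $0<\varepsilon<\varepsilon_0$ there is an integer $n$ with $a\varepsilon^{-2}\le n\le b\varepsilon^{-2}$ such that the following holds. Let $T_\varepsilon\subseteq\mathbb{R}^n$ be the origin-centered Euclidean sphere scaled so that $w(T_\varepsilon)=1$. If $S\subseteq T_\varepsilon$ is finite and nonempty and $\{c_s\}_{s\in S}$ are arbitrary real numbers satisfying $$\left\|\sup_{t\in T_\varepsilon} g\cdot t-\max_{s\in S}\{g\cdot s+c_s\}\right\|_{L^1}\le\varepsilon,$$ then $|S|\ge\exp(c/\varepsilon^2)$.
   Context: Here $g\sim N(0,I_n)$ is a standard Gaussian vector in $\mathbb{R}^n$, $\|F\|_{L^1}=\mathbb{E}_{g\sim N(0,I_n)}[|F(g)|]$, and $w(T)=\mathbb{E}_{g\sim N(0,I_n)}[\sup_{t\in T}g\cdot t]$ is the Gaussian width of $T$. *)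

theory Defs
  imports "HOL-Probability.Probability"
begin

text \<open>
  The dimension is quantified inside the statement, so \<open>\<real>\<^sup>n\<close> is carried by the extensional
  functions on \<open>{..<n}\<close>. Extensionality matters for the cardinality of sets of points.
\<close>

definition Rn :: "nat \<Rightarrow> (nat \<Rightarrow> real) set" where
  "Rn n = ({..<n} \<rightarrow>\<^sub>E UNIV)"

definition dot :: "nat \<Rightarrow> (nat \<Rightarrow> real) \<Rightarrow> (nat \<Rightarrow> real) \<Rightarrow> real" where
  "dot n x y = (\<Sum>i<n. x i * y i)"

definition centered_sphere :: "nat \<Rightarrow> real \<Rightarrow> (nat \<Rightarrow> real) set" where
  "centered_sphere n r = {x \<in> Rn n. L2_set x {..<n} = r}"

definition gauss :: "nat \<Rightarrow> (nat \<Rightarrow> real) measure" where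
  "gauss n = (\<Pi>\<^sub>M i\<in>{..<n}. std_normal_distribution)"

text \<open>
  As an extended nonnegative integral, so that a function that is not integrable has norm
  \<open>\<infinity>\<close> rather than the default value \<open>0\<close> of the Bochner integral.
\<close>

definition gauss_L1 :: "nat \<Rightarrow> ((nat \<Rightarrow> real) \<Rightarrow> real) \<Rightarrow> ennreal" where
  "gauss_L1 n F = (\<integral>\<^sup>+ g. ennreal \<bar>F g\<bar> \<partial>gauss n)"

text \<open>Meaningful for nonempty bounded \<open>T\<close>, where the real supremum is the genuine one.\<close>

definition gaussian_width :: "nat \<Rightarrow> (nat \<Rightarrow> real) set \<Rightarrow> real" where
  "gaussian_width n T = (\<integral>g. (SUP t\<in>T. dot n g t) \<partial>gauss n)"

lemma space_gauss: "space (gauss n) = Rn n"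
  by (simp add: gauss_def Rn_def space_PiM)

lemma SUP_centered_sphere:
  assumes "0 < n" "0 \<le> r"
  shows "(SUP t\<in>centered_sphere n r. dot n g t) = r * L2_set g {..<n}"
proof (rule cSup_eq_maximum)
  define N where "N = L2_set g {..<n}"
  show "r * L2_set g {..<n} \<in> dot n g ` centered_sphere n r"
  proof (cases "N = 0")
    case True
    define t where "t = restrict (\<lambda>i. if i = 0 then r else 0) {..<n}"
    have "L2_set t {..<n} = sqrt (\<Sum>i<n. if i = 0 then r\<^sup>2 else 0)"
      unfolding L2_set_def t_def by (intro arg_cong[where f=sqrt] sum.cong) auto
    also have "\<dots> = r" using assms by simp
    finally have "t \<in> centered_sphere n r"
      by (simp add: centered_sphere_def Rn_def t_def)
    moreover have "dot n g t = 0"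
      using True unfolding N_def dot_def by (simp add: L2_set_eq_0_iff)
    ultimately show ?thesis using True by (force simp: N_def)
  next
    case False
    then have N: "N > 0" by (simp add: N_def less_le)
    define t where "t = restrict (\<lambda>i. (r / N) * g i) {..<n}"
    have "L2_set t {..<n} = L2_set (\<lambda>i. (r / N) * g i) {..<n}"
      by (rule L2_set_cong) (auto simp: t_def)
    also have "\<dots> = (r / N) * N"
      unfolding N_def[symmetric] using N assms 
      by (subst L2_set_right_distrib[symmetric]) (auto simp: N_def)
    finally have "t \<in> centered_sphere n r"
      using N by (simp add: centered_sphere_def Rn_def t_def)
    moreover have "dot n g t = (r / N) * (\<Sum>i<n. (g i)\<^sup>2)"
      unfolding dot_def t_def sum_distrib_left by (intro sum.cong) (auto simp: power2_eq_square)
    moreover have "(\<Sum>i<n. (g i)\<^sup>2) = N * N"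
      by (simp add: N_def L2_set_def sum_nonneg)
    ultimately show ?thesis using N by (force simp: N_def[symmetric])
  qed
next
  fix x assume "x \<in> dot n g ` centered_sphere n r"
  then obtain t where t: "t \<in> centered_sphere n r" "x = dot n g t" by auto
  have "dot n g t \<le> (\<Sum>i<n. \<bar>g i\<bar> * \<bar>t i\<bar>)"
    unfolding dot_def by (intro sum_mono) (metis abs_ge_self abs_mult)
  also have "\<dots> \<le> L2_set g {..<n} * L2_set t {..<n}" by (rule L2_set_mult_ineq)
  finally show "x \<le> r * L2_set g {..<n}" using t by (simp add: centered_sphere_def mult.commute)
qed

lemma gauss_norm:
  assumes "0 < n"
  shows "integrable (gauss n) (\<lambda>g. L2_set g {..<n})"
    and "0 < (\<integral>g. L2_set g {..<n} \<partial>gauss n)"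
proof -
  let ?X = "std_normal_distribution"
  have m[measurable]: "(\<lambda>g. g i) \<in> measurable (gauss n) ?X" if "i < n" for i
    unfolding gauss_def using that by simp
  have mb[measurable]: "(\<lambda>g. g i) \<in> borel_measurable (gauss n)" if "i < n" for i
    using m[OF that] by simp
  have D: "distr (gauss n) ?X (\<lambda>g. g i) = ?X" if "i < n" for i
    unfolding gauss_def using that
    by (intro distr_PiM_component) (auto simp: prob_space_normal_density)
  have hb: "has_bochner_integral lborel (\<lambda>x. std_normal_density x * \<bar>x\<bar>) (sqrt (2 / pi))"
    using std_normal_moment_abs_odd[of 0] by simp
  have X: "integrable ?X (\<lambda>x. \<bar>x\<bar>)" "integral\<^sup>L ?X (\<lambda>x. \<bar>x\<bar>) = sqrt (2 / pi)"
    using hb by (auto simp: integrable_density integral_density has_bochner_integral_iff)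
  have I: "integrable (gauss n) (\<lambda>g. \<bar>g i\<bar>)" 
       "integral\<^sup>L (gauss n) (\<lambda>g. \<bar>g i\<bar>) = sqrt (2 / pi)" if i: "i < n" for i
    using X integrable_distr_eq[OF m[OF i], of "\<lambda>x. \<bar>x\<bar>"] 
      integral_distr[OF m[OF i], of "\<lambda>x. \<bar>x\<bar>"] by (simp_all add: D[OF i])
  show int: "integrable (gauss n) (\<lambda>g. L2_set g {..<n})"
  proof (rule Bochner_Integration.integrable_bound)
    show "integrable (gauss n) (\<lambda>g. \<Sum>i<n. \<bar>g i\<bar>)" using I by auto
    show "(\<lambda>g. L2_set g {..<n}) \<in> borel_measurable (gauss n)"
      unfolding L2_set_def by measurable
    show "AE g in gauss n. norm (L2_set g {..<n}) \<le> norm (\<Sum>i<n. \<bar>g i\<bar>)"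
      by (auto simp: L2_set_le_sum_abs sum_nonneg)
  qed
  have "0 < sqrt (2 / pi)" by simp
  also have "\<dots> = integral\<^sup>L (gauss n) (\<lambda>g. \<bar>g 0\<bar>)" using I assms by simp
  also have "\<dots> \<le> (\<integral>g. L2_set g {..<n} \<partial>gauss n)"
  proof (rule integral_mono[OF I(1)[OF assms] int])
    fix g :: "nat \<Rightarrow> real"
    have "L2_set (\<lambda>i. \<bar>g i\<bar>) {..<n} = L2_set g {..<n}" by (simp add: L2_set_def)
    then show "\<bar>g 0\<bar> \<le> L2_set g {..<n}"
      using member_le_L2_set[of "{..<n}" 0 "\<lambda>i. \<bar>g i\<bar>"] assms by auto
  qed
  finally show "0 < (\<integral>g. L2_set g {..<n} \<partial>gauss n)" .
qed

text \<open>Hence ``the origin-centered sphere of Gaussian width 1'' is well defined.\<close>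

lemma ex1_unit_width_sphere:
  assumes "0 < n"
  shows "\<exists>!r. 0 < r \<and> gaussian_width n (centered_sphere n r) = 1"
proof -
  define E where "E = (\<integral>g. L2_set g {..<n} \<partial>gauss n)"
  have E: "E > 0" using gauss_norm[OF assms] by (simp add: E_def)
  have w: "gaussian_width n (centered_sphere n r) = r * E" if "0 < r" for r
    using that assms by (simp add: gaussian_width_def SUP_centered_sphere E_def)
  show ?thesis
  proof (rule ex1I[of _ "1 / E"])
    show "0 < 1 / E \<and> gaussian_width n (centered_sphere n (1 / E)) = 1" using w[of "1/E"] E by simp
    show "r = 1 / E" if "0 < r \<and> gaussian_width n (centered_sphere n r) = 1" for r
      using that w E by (auto simp: field_simps)
  qed
qed

end

theory Submission
  imports Defs
begin

text \<open>
  Compare radial growth. Under \<open>g \<mapsto> l * g\<close> with \<open>l = sqrt (1 + 1 / sqrt n)\<close> the supremum over the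
  sphere grows by \<open>(l - 1) * r * \<bar>g\<bar>\<close>, about \<open>l - 1\<close>, while the maximum grows by at most
  \<open>(l - 1) * (MAX s\<in>S. g \<cdot> s)\<close>: the shifts cancel. If \<open>card S \<le> exp (n / 72)\<close> then the latter
  maximum is at most \<open>1 / 4\<close> in the mean, so the error at \<open>g\<close> or at \<open>l * g\<close> is of order \<open>1 / sqrt n\<close>.
  Both errors are controlled by the same \<open>L\<^sup>1\<close> norm because, off a set of small probability, the
  change of measure from \<open>g\<close> to \<open>l * g\<close> has bounded density. Taking \<open>n\<close> to be a small multiple of
  \<open>1 / \<epsilon>\<^sup>2\<close> gives the contradiction.
\<close>

section \<open>One-dimensional Gaussian integrals\<close>

lemma has_bochner_integral_std_normal:
  fixes f :: "real \<Rightarrow> real"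
  assumes [measurable]: "f \<in> borel_measurable borel"
    and "has_bochner_integral lborel (\<lambda>x. std_normal_density x * f x) a"
  shows "has_bochner_integral std_normal_distribution f a"
  using assms(2) by (auto simp: has_bochner_integral_iff integrable_density integral_density)

lemma has_bochner_integral_normal_density:
  "has_bochner_integral lborel (normal_density \<mu> \<sigma>) 1" if "0 < \<sigma>"
  using that by (simp add: has_bochner_integral_iff)

text \<open>Completing the square: tilting the standard density by \<open>exp (t * x)\<close> gives
  a multiple of the normal density centred at \<open>t\<close>.\<close>

lemma std_normal_mgf:
  "has_bochner_integral std_normal_distribution (\<lambda>x. exp (t * x)) (exp (t\<^sup>2 / 2))"
proof (rule has_bochner_integral_std_normal)
  have "std_normal_density x * exp (t * x) = exp (t\<^sup>2 / 2) * normal_density t 1 x" for x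
    by (simp add: normal_density_def exp_add[symmetric] power2_eq_square field_simps)
  then show "has_bochner_integral lborel (\<lambda>x. std_normal_density x * exp (t * x)) (exp (t\<^sup>2 / 2))"
    using has_bochner_integral_mult_right[OF has_bochner_integral_normal_density[of 1 t], of "exp (t\<^sup>2 / 2)"]
    by simp
qed simp

text \<open>The tilted density is a multiple of a centred normal density with variance
  \<open>1 / (1 - u)\<close>, which is positive because \<open>u < 1\<close>.\<close>

lemma std_normal_exp_square:
  assumes "u < 1"
  shows "has_bochner_integral std_normal_distribution (\<lambda>x. exp (u * x\<^sup>2 / 2)) (1 / sqrt (1 - u))"
proof (rule has_bochner_integral_std_normal)
  define \<sigma> where "\<sigma> = 1 / sqrt (1 - u)"
  have \<sigma>: "\<sigma> > 0" "1 / \<sigma>\<^sup>2 = 1 - u" using assms by (auto simp: \<sigma>_def power_divide)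
  have "std_normal_density x * exp (u * x\<^sup>2 / 2) = \<sigma> * normal_density 0 \<sigma> x" for x
  proof -
    have "- x\<^sup>2 / (2 * \<sigma>\<^sup>2) = - x\<^sup>2 / 2 * (1 / \<sigma>\<^sup>2)" by simp
    also have "\<dots> = - x\<^sup>2 / 2 + u * x\<^sup>2 / 2" unfolding \<sigma>(2) by (simp add: field_simps)
    finally have "exp (- x\<^sup>2 / 2) * exp (u * x\<^sup>2 / 2) = exp (- x\<^sup>2 / (2 * \<sigma>\<^sup>2))"
      by (simp add: exp_add[symmetric])
    then show ?thesis
      using \<sigma>(1) by (simp add: normal_density_def real_sqrt_mult)
  qed
  then show "has_bochner_integral lborel (\<lambda>x. std_normal_density x * exp (u * x\<^sup>2 / 2)) (1 / sqrt (1 - u))"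
    using has_bochner_integral_mult_right[OF has_bochner_integral_normal_density[OF \<sigma>(1), of 0], of \<sigma>]
    by (simp add: \<sigma>_def)
qed simp

text \<open>The weight is \<open>l\<close> times the ratio of the standard density at
  \<open>l * x\<close> to that at \<open>x\<close>, so the claim is the substitution of
  \<open>l * x\<close> for \<open>x\<close>.\<close>

lemma std_normal_scaling:
  assumes "0 < l" and [measurable]: "f \<in> borel_measurable borel"
  shows "(\<integral>\<^sup>+x. ennreal (l * exp (- ((l\<^sup>2 - 1) * x\<^sup>2 / 2))) * f (l * x) \<partial>std_normal_distribution) =
    (\<integral>\<^sup>+x. f x \<partial>std_normal_distribution)"
proof -
  have *: "std_normal_density x * (l * exp (- ((l\<^sup>2 - 1) * x\<^sup>2 / 2))) = l * std_normal_density (l * x)" for x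
  proof -
    have "exp (- x\<^sup>2 / 2) * exp (- ((l\<^sup>2 - 1) * x\<^sup>2 / 2)) = exp (- (l * x)\<^sup>2 / 2)"
      unfolding exp_add[symmetric] by (simp add: algebra_simps power_mult_distrib add_divide_distrib diff_divide_distrib)
    then show ?thesis by (simp add: normal_density_def)
  qed
  have "(\<integral>\<^sup>+x. ennreal (l * exp (- ((l\<^sup>2 - 1) * x\<^sup>2 / 2))) * f (l * x) \<partial>std_normal_distribution) =
    (\<integral>\<^sup>+x. ennreal (std_normal_density x * (l * exp (- ((l\<^sup>2 - 1) * x\<^sup>2 / 2)))) * f (l * x) \<partial>lborel)"
    using assms(1) by (subst nn_integral_density) (auto simp: ennreal_mult mult.assoc)
  also have "\<dots> = (\<integral>\<^sup>+x. ennreal l * (ennreal (std_normal_density (l * x)) * f (l * x)) \<partial>lborel)"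
    unfolding * using assms(1) by (simp add: ennreal_mult mult.assoc)
  also have "\<dots> = (\<integral>\<^sup>+x. ennreal (std_normal_density x) * f x \<partial>lborel)"
    using assms(1) by (subst nn_integral_real_affine[where c = l and t = 0]) (auto simp: nn_integral_cmult)
  also have "\<dots> = (\<integral>\<^sup>+x. f x \<partial>std_normal_distribution)"
    by (subst nn_integral_density) auto
  finally show ?thesis .
qed

section \<open>Moments and exponential moments of the Gaussian vector\<close>

interpretation std_normal_product: product_prob_space "\<lambda>_::nat. std_normal_distribution" UNIV
  by (intro product_prob_spaceI prob_space_normal_density) simp

lemma measurable_gauss_component [measurable]:
  "i < n \<Longrightarrow> (\<lambda>g. g i) \<in> borel_measurable (gauss n)"
proof -
  assume "i < n"
  then have "(\<lambda>g. g i) \<in> measurable (gauss n) std_normal_distribution" by (simp add: gauss_def)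
  then show ?thesis by simp
qed

lemma gauss_prod:
  fixes f :: "nat \<Rightarrow> real \<Rightarrow> real"
  assumes "\<And>i. i < n \<Longrightarrow> has_bochner_integral std_normal_distribution (f i) (a i)"
  shows "has_bochner_integral (gauss n) (\<lambda>g. \<Prod>i<n. f i (g i)) (\<Prod>i<n. a i)"
proof -
  have i: "integrable std_normal_distribution (f i)" if "i < n" for i
    using assms[OF that] by (simp add: has_bochner_integral_iff)
  have "(\<Prod>i<n. a i) = (\<Prod>i<n. integral\<^sup>L std_normal_distribution (f i))"
    using assms by (intro prod.cong) (auto simp: has_bochner_integral_iff)
  then show ?thesis
    using i std_normal_product.product_integrable_prod[of "{..<n}" f]
      std_normal_product.product_integral_prod[of "{..<n}" f]
    by (simp add: has_bochner_integral_iff gauss_def)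
qed

lemma gauss_component:
  fixes f :: "real \<Rightarrow> real"
  assumes "has_bochner_integral std_normal_distribution f a" "i < n"
  shows "has_bochner_integral (gauss n) (\<lambda>g. f (g i)) a"
proof -
  have "has_bochner_integral std_normal_distribution (if j = i then f else (\<lambda>_. 1)) (if j = i then a else 1)" for j
    using assms(1) std_normal_product.M.prob_space by (auto simp: has_bochner_integral_iff)
  from gauss_prod[of n "\<lambda>j. if j = i then f else (\<lambda>_. 1)" "\<lambda>j. if j = i then a else 1", OF this]
  have "has_bochner_integral (gauss n) (\<lambda>g. \<Prod>j<n. (if j = i then f else (\<lambda>_. 1)) (g j)) (\<Prod>j<n. if j = i then a else 1)" .
  moreover have "(\<Prod>j<n. (if j = i then f else (\<lambda>_. 1)) (g j)) = f (g i)" for g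
  proof -
    have "(\<Prod>j<n. (if j = i then f else (\<lambda>_. 1)) (g j)) = (\<Prod>j<n. if j = i then f (g j) else 1)"
      by (intro prod.cong) auto
    then show ?thesis using assms(2) by simp
  qed
  ultimately show ?thesis using assms(2) by simp
qed

lemma gauss_norm_square:
  "has_bochner_integral (gauss n) (\<lambda>g. (L2_set g {..<n})\<^sup>2) (real n)"
proof -
  have "has_bochner_integral std_normal_distribution (\<lambda>x. x\<^sup>2) 1"
    using std_normal_moment_even[of 1] by (intro has_bochner_integral_std_normal) (auto simp: fact_numeral)
  then have "has_bochner_integral (gauss n) (\<lambda>g. \<Sum>i<n. (g i)\<^sup>2) (\<Sum>i<n. 1)"
    by (intro has_bochner_integral_sum gauss_component[where f = "\<lambda>x. x\<^sup>2"]) auto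
  then show ?thesis by (simp add: L2_set_def sum_nonneg)
qed

text \<open>Cauchy-Schwarz against the all-ones vector bounds the norm below by the normalized sum
  of the \<open>\<bar>g i\<bar>\<close>, whose mean is explicit. On the sphere of width 1 this
  bounds \<open>r * sqrt n\<close> from above.\<close>

lemma gauss_norm_lower:
  assumes "0 < n"
  shows "sqrt (2 / pi) * sqrt n \<le> (\<integral>g. L2_set g {..<n} \<partial>gauss n)"
proof -
  have "has_bochner_integral std_normal_distribution (\<lambda>x. \<bar>x\<bar>) (sqrt (2 / pi))"
    using std_normal_moment_abs_odd[of 0] by (intro has_bochner_integral_std_normal) auto
  then have *: "has_bochner_integral (gauss n) (\<lambda>g. (\<Sum>i<n. \<bar>g i\<bar>) / sqrt n) ((\<Sum>i<n. sqrt (2 / pi)) / sqrt n)"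
    using assms by (intro has_bochner_integral_divide has_bochner_integral_sum gauss_component[where f = "\<lambda>x. \<bar>x\<bar>"]) auto
  have "sqrt (2 / pi) * sqrt n = (\<Sum>i<n. sqrt (2 / pi)) / sqrt n"
    using assms by (simp add: field_simps)
  also have "\<dots> = (\<integral>g. (\<Sum>i<n. \<bar>g i\<bar>) / sqrt n \<partial>gauss n)"
    by (rule has_bochner_integral_integral_eq[OF *, symmetric])
  also have "\<dots> \<le> (\<integral>g. L2_set g {..<n} \<partial>gauss n)"
  proof (rule integral_mono)
    fix g
    have "(\<Sum>i<n. \<bar>g i\<bar> * \<bar>1\<bar>) \<le> L2_set g {..<n} * L2_set (\<lambda>_. 1) {..<n}"
      by (rule L2_set_mult_ineq)
    then show "(\<Sum>i<n. \<bar>g i\<bar>) / sqrt n \<le> L2_set g {..<n}"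
      using assms by (simp add: L2_set_def field_simps)
  qed (use * assms in \<open>auto simp: has_bochner_integral_iff gauss_norm\<close>)
  finally show ?thesis .
qed

text \<open>By independence the exponential factors over coordinates. The mean depends on
  \<open>s\<close> only through its norm, so it is the same for all points of a sphere.\<close>

lemma gauss_dot_mgf:
  "has_bochner_integral (gauss n) (\<lambda>g. exp (t * dot n g s)) (exp (t\<^sup>2 * (L2_set s {..<n})\<^sup>2 / 2))"
proof -
  have "has_bochner_integral (gauss n) (\<lambda>g. \<Prod>i<n. exp ((t * s i) * g i)) (\<Prod>i<n. exp ((t * s i)\<^sup>2 / 2))"
    by (intro gauss_prod std_normal_mgf)
  then show ?thesis
    by (simp add: exp_sum[symmetric] dot_def L2_set_def sum_nonneg sum_distrib_left sum_divide_distrib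
        power_mult_distrib mult_ac)
qed

lemma gauss_exp_norm_square:
  assumes "u < 1"
  shows "has_bochner_integral (gauss n) (\<lambda>g. exp (u * (L2_set g {..<n})\<^sup>2 / 2)) ((1 / sqrt (1 - u)) ^ n)"
  using gauss_prod[OF std_normal_exp_square[OF assms], of n]
  by (simp add: exp_sum[symmetric] L2_set_def sum_nonneg sum_distrib_left sum_divide_distrib)

section \<open>Change of measure under scaling\<close>

text \<open>The restriction keeps the image extensional, hence inside the space of
  \<open>gauss n\<close>.\<close>

definition scale_vec :: "nat \<Rightarrow> real \<Rightarrow> (nat \<Rightarrow> real) \<Rightarrow> nat \<Rightarrow> real" where
  "scale_vec n l g = (\<lambda>i\<in>{..<n}. l * g i)"

lemma dot_scale_vec: "dot n (scale_vec n l g) s = l * dot n g s"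
  by (simp add: dot_def scale_vec_def sum_distrib_left mult.assoc)

lemma L2_set_scale_vec: "0 \<le> l \<Longrightarrow> L2_set (scale_vec n l g) {..<n} = l * L2_set g {..<n}"
  unfolding L2_set_right_distrib by (rule L2_set_cong) (auto simp: scale_vec_def)

lemma measurable_scale_vec [measurable]: "scale_vec n l \<in> measurable (gauss n) (gauss n)"
proof -
  have "(\<lambda>g. \<lambda>i\<in>{..<n}. l * g i) \<in> measurable (gauss n) (\<Pi>\<^sub>M i\<in>{..<n}. std_normal_distribution)"
    by (rule measurable_restrict) simp
  then show ?thesis by (simp add: scale_vec_def[abs_def] gauss_def)
qed

text \<open>For \<open>l > 0\<close> this is the density, relative to \<open>gauss n\<close>, of the
  law of a Gaussian vector divided by \<open>l\<close>; the factor \<open>l ^ n\<close> is the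
  Jacobian.\<close>

definition scale_weight :: "nat \<Rightarrow> real \<Rightarrow> (nat \<Rightarrow> real) \<Rightarrow> real" where
  "scale_weight n l g = l ^ n * exp (- ((l\<^sup>2 - 1) * (L2_set g {..<n})\<^sup>2 / 2))"

lemma scale_weight_prod:
  "scale_weight n l g = (\<Prod>i<n. l * exp (- ((l\<^sup>2 - 1) * (g i)\<^sup>2 / 2)))"
  by (simp add: scale_weight_def prod.distrib exp_sum[symmetric] L2_set_def sum_nonneg sum_distrib_left
      sum_divide_distrib sum_negf)

lemma measurable_L2_gauss [measurable]: "(\<lambda>g. L2_set g {..<n}) \<in> borel_measurable (gauss n)"
  unfolding L2_set_def by measurable

lemma measurable_scale_weight [measurable]: "scale_weight n l \<in> borel_measurable (gauss n)"
  unfolding scale_weight_def[abs_def] by measurable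

text \<open>A product measure is determined by its values on boxes, and on a box both the weight and
  the indicator factor into coordinates, where \<open>std_normal_scaling\<close> applies.\<close>

lemma gauss_scaling:
  assumes "0 < l"
  shows "distr (density (gauss n) (\<lambda>g. ennreal (scale_weight n l g))) (gauss n) (scale_vec n l) = gauss n"
proof -
  let ?w = "\<lambda>x::real. ennreal (l * exp (- ((l\<^sup>2 - 1) * x\<^sup>2 / 2)))"
  let ?P = "distr (density (gauss n) (\<lambda>g. ennreal (scale_weight n l g))) (gauss n) (scale_vec n l)"
  have "?P = (\<Pi>\<^sub>M i\<in>{..<n}. std_normal_distribution)"
  proof (rule std_normal_product.PiM_eqI)
    show "sets ?P = sets (\<Pi>\<^sub>M i\<in>{..<n}. std_normal_distribution)" by (simp add: gauss_def)
  next
    fix A :: "nat \<Rightarrow> real set"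
    assume A: "\<And>i. i \<in> {..<n} \<Longrightarrow> A i \<in> sets std_normal_distribution"
    then have B[measurable]: "A i \<in> sets borel" if "i < n" for i using that by simp
    have S[measurable]: "Pi\<^sub>E {..<n} A \<in> sets (gauss n)"
      unfolding gauss_def using A by (intro sets_PiM_I_finite) auto
    have eq: "ennreal (scale_weight n l g) * indicator (Pi\<^sub>E {..<n} A) (scale_vec n l g) =
        (\<Prod>i<n. ?w (g i) * indicator (A i) (l * g i))" for g
    proof -
      have "(\<Prod>i<n. indicator (A i) (l * g i)) = (indicator (Pi\<^sub>E {..<n} A) (scale_vec n l g) :: ennreal)"
      proof (cases "\<forall>i<n. l * g i \<in> A i")
        case True
        then show ?thesis by (auto simp: scale_vec_def indicator_def)
      next
        case False
        then obtain i where i: "i < n" "l * g i \<notin> A i" by auto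
        then have "(\<Prod>i<n. indicator (A i) (l * g i)) = (0::ennreal)"
          by (intro prod_zero) (auto intro!: bexI[of _ i])
        moreover have "scale_vec n l g \<notin> Pi\<^sub>E {..<n} A" using i by (auto simp: scale_vec_def PiE_def Pi_def)
        ultimately show ?thesis by simp
      qed
      moreover have "ennreal (scale_weight n l g) = (\<Prod>i<n. ?w (g i))"
        unfolding scale_weight_prod using assms by (intro prod_ennreal[symmetric]) auto
      ultimately show ?thesis by (simp add: prod.distrib)
    qed
    have "emeasure ?P (Pi\<^sub>E {..<n} A) = (\<integral>\<^sup>+g. indicator (Pi\<^sub>E {..<n} A) g \<partial>?P)"
      by simp
    also have "\<dots> = (\<integral>\<^sup>+g. ennreal (scale_weight n l g) * indicator (Pi\<^sub>E {..<n} A) (scale_vec n l g) \<partial>gauss n)"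
      by (simp add: nn_integral_distr nn_integral_density del: nn_integral_indicator)
    also have "\<dots> = (\<integral>\<^sup>+g. (\<Prod>i<n. ?w (g i) * indicator (A i) (l * g i)) \<partial>gauss n)"
      by (simp only: eq)
    also have "\<dots> = (\<Prod>i<n. \<integral>\<^sup>+x. ?w x * indicator (A i) (l * x) \<partial>std_normal_distribution)"
      unfolding gauss_def by (rule std_normal_product.product_nn_integral_prod) auto
    also have "\<dots> = (\<Prod>i<n. emeasure std_normal_distribution (A i))"
      using A assms by (intro prod.cong refl) (subst std_normal_scaling, auto)
    finally show "emeasure ?P (Pi\<^sub>E {..<n} A) = (\<Prod>i\<in>{..<n}. emeasure std_normal_distribution (A i))" .
  qed simp
  then show ?thesis by (simp add: gauss_def)
qed

text \<open>This charges the weighted error at the scaled point to the same L1 norm as the error at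
  the original point.\<close>

lemma gauss_integral_scaling:
  fixes f :: "(nat \<Rightarrow> real) \<Rightarrow> real"
  assumes "0 < l" "integrable (gauss n) f"
  shows "has_bochner_integral (gauss n) (\<lambda>g. scale_weight n l g * f (scale_vec n l g)) (\<integral>g. f g \<partial>gauss n)"
proof -
  have [measurable]: "f \<in> borel_measurable (gauss n)" using assms by simp
  have w: "0 \<le> scale_weight n l g" for g using assms by (simp add: scale_weight_def)
  let ?D = "density (gauss n) (\<lambda>g. ennreal (scale_weight n l g))"
  have "integrable (distr ?D (gauss n) (scale_vec n l)) f" using assms by (simp add: gauss_scaling)
  moreover have "integral\<^sup>L (distr ?D (gauss n) (scale_vec n l)) f = integral\<^sup>L (gauss n) f"
    using assms by (simp add: gauss_scaling)
  ultimately show ?thesis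
    using w by (simp add: has_bochner_integral_iff integrable_distr_eq integral_distr integrable_density
        integral_density)
qed


section \<open>Few points force a large L1 error\<close>

interpretation gauss: prob_space "gauss n" for n
  unfolding gauss_def by (intro prob_space_PiM prob_space_normal_density) simp

lemma measurable_dot_gauss [measurable]: "(\<lambda>g. dot n g s) \<in> borel_measurable (gauss n)"
  unfolding dot_def by measurable

text \<open>Integrating the pointwise inequality \<open>key\<close> bounds the mean radial growth
  \<open>l - 1\<close> by 129 times the L1 error plus \<open>17 / 32\<close> of itself. The rest,
  \<open>15 / 32 * (l - 1)\<close>, is of order \<open>1 / sqrt n\<close> and must be paid by the
  error.\<close>

lemma sphere_approximation_bound:
  fixes S :: "(nat \<Rightarrow> real) set" and cs :: "(nat \<Rightarrow> real) \<Rightarrow> real"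
  defines "F n r g \<equiv> r * L2_set g {..<n} - Max ((\<lambda>s. dot n g s + cs s) ` S)"
  assumes n: "72 \<le> n" and r: "0 < r" "r * (\<integral>g. L2_set g {..<n} \<partial>gauss n) = 1"
    and S: "S \<subseteq> centered_sphere n r" "finite S" "S \<noteq> {}" "real (card S) \<le> exp (real n / 72)"
    and F: "integrable (gauss n) (F n r)" "(\<integral>g. \<bar>F n r g\<bar> \<partial>gauss n) \<le> \<epsilon>"
  shows "5 / 32 \<le> 129 * \<epsilon> * sqrt n"
proof -
  define N where "N g = L2_set g {..<n}" for g :: "nat \<Rightarrow> real"
  define f where "f = F n r"
  \<comment> \<open>With \<open>l\<^sup>2 = 1 + u\<close>, the mean of \<open>q\<close> is
    \<open>(1 - u\<^sup>2)\<close> to the power \<open>- n / 2\<close>; taking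
    \<open>u\<^sup>2 = 1 / n\<close> keeps it bounded uniformly in \<open>n\<close>.\<close>
  define u where "u = 1 / sqrt n"
  define l where "l = sqrt (1 + u)"
  define w where "w = scale_weight n l"
  define q where "q g = exp (u * (N g)\<^sup>2 / 2) / l ^ n" for g
  \<comment> \<open>\<open>exp m\<close> bounds \<open>card S\<close> times the common mean of
    \<open>exp (\<theta> * dot n g s)\<close>, so the sum in \<open>Y\<close> has mean at most 1. As
    \<open>r * sqrt n\<close> is bounded, a \<theta> proportional to \<open>n\<close> keeps
    \<open>m / \<theta>\<close> bounded.\<close>
  define \<theta> where "\<theta> = real n / 9"
  define m where "m = \<theta>\<^sup>2 * r\<^sup>2 / 2 + real n / 72"
  define Y where "Y g = (m - 1 + (\<Sum>s\<in>S. exp (\<theta> * dot n g s) * exp (- m))) / \<theta>" for g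
  define X where "X g = Max (dot n g ` S)" for g
  define M where "M g = Max ((\<lambda>s. dot n g s + cs s) ` S)" for g
  define Z where "Z g = r * ((N g)\<^sup>2 / (8 * sqrt n) + 2 * sqrt n * (q g / 128))" for g
  have sn: "sqrt n > 0" "sqrt n * sqrt n = n" using n by auto
  have sn1: "sqrt n \<ge> sqrt 4" using n by (intro real_sqrt_le_mono) simp
  have u: "0 < u" "u \<le> 1 / 2" "u\<^sup>2 = 1 / n" using n sn1 by (auto simp: u_def field_simps power_divide)
  have l2: "l\<^sup>2 = 1 + u" using u by (simp add: l_def)
  have l1: "1 < l" using u by (simp add: l_def)
  have "l < 2" using u by (auto simp: l_def intro!: real_less_lsqrt)
  have "u = (l - 1) * (l + 1)" using l2 by (simp add: power2_eq_square algebra_simps)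
  also have "\<dots> \<le> (l - 1) * 3" using \<open>l < 2\<close> l1 by (intro mult_left_mono) auto
  finally have ul: "u \<le> 3 * (l - 1)" by simp
  have \<theta>: "\<theta> > 0" using n by (simp add: \<theta>_def)
  have m1: "m \<ge> 1" using n by (simp add: m_def add_increasing)
  have wq: "w g * q g = 1" for g
  proof -
    have "w g * q g = l ^ n * exp (- (u * (N g)\<^sup>2 / 2)) * (exp (u * (N g)\<^sup>2 / 2) / l ^ n)"
      by (simp add: w_def scale_weight_def q_def l2 N_def)
    also have "\<dots> = 1" using l1 by (simp add: exp_minus)
    finally show ?thesis .
  qed
  have q0: "q g > 0" for g using l1 by (simp add: q_def)
  have w0: "w g \<ge> 0" for g using l1 by (simp add: w_def scale_weight_def)
  have Nn: "N g \<ge> 0" for g by (simp add: N_def)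
  have fM: "f g = r * N g - M g" for g by (simp add: f_def F_def N_def M_def)

  have Y0: "Y g \<ge> 0" for g using \<theta> m1 by (auto simp: Y_def intro!: divide_nonneg_pos add_nonneg_nonneg sum_nonneg)
  txt \<open>Soft maximum, with \<open>ln t \<le> t / e\<^sup>m + m - 1\<close> in place of Jensen's inequality.\<close>
  have XY: "X g \<le> Y g" for g
  proof -
    have "X g \<in> dot n g ` S" unfolding X_def using S by (intro Max_in) auto
    then obtain s where s: "s \<in> S" "X g = dot n g s" by auto
    have "\<theta> * dot n g s \<le> m - 1 + exp (\<theta> * dot n g s - m)"
      using exp_ge_add_one_self[of "\<theta> * dot n g s - m"] by linarith
    also have "exp (\<theta> * dot n g s - m) = exp (\<theta> * dot n g s) * exp (- m)"
      by (simp add: exp_add[symmetric])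
    also have "\<dots> \<le> (\<Sum>s\<in>S. exp (\<theta> * dot n g s) * exp (- m))"
      using S s by (intro member_le_sum) auto
    finally show ?thesis using \<theta> by (simp add: Y_def s field_simps)
  qed
  \<comment> \<open>Each affine piece at the scaled point is its value at \<open>g\<close>, shift
    included, plus \<open>(l - 1) * dot n g s\<close>; the two summands are bounded by separate
    maxima.\<close>
  have MX: "M (scale_vec n l g) \<le> M g + (l - 1) * X g" for g
    unfolding M_def[of "scale_vec n l g"]
  proof (rule Max.boundedI)
    fix a assume "a \<in> (\<lambda>s. dot n (scale_vec n l g) s + cs s) ` S"
    then obtain s where s: "s \<in> S" "a = l * dot n g s + cs s" by (auto simp: dot_scale_vec)
    have "dot n g s + cs s \<le> M g" "dot n g s \<le> X g"
      unfolding M_def X_def using S s by (auto intro!: Max_ge)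
    moreover from this l1 have "(l - 1) * dot n g s \<le> (l - 1) * X g" by (intro mult_left_mono) auto
    ultimately show "a \<le> M g + (l - 1) * X g" by (simp add: s algebra_simps)
  qed (use S in auto)
  have Z0: "Z g \<ge> 0" for g using r q0[of g] by (auto simp: Z_def intro!: mult_nonneg_nonneg add_nonneg_nonneg)

  txt \<open>\<open>q = 1 / w\<close> is large only with small probability, since its mean \<open>Q\<close> is at most \<open>4\<close>;
    there the radial growth is absorbed by \<open>Z\<close>.\<close>
  have key: "(l - 1) * (r * N g) \<le> 128 * (w g * \<bar>f (scale_vec n l g)\<bar>) + \<bar>f g\<bar> + (l - 1) * (Y g + Z g)" for g
  proof (cases "q g \<le> 128")
    case True
    have "f (scale_vec n l g) - f g \<ge> (l - 1) * (r * N g) - (l - 1) * X g"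
      using MX[of g] l1 by (simp add: fM N_def L2_set_scale_vec algebra_simps)
    moreover have "(l - 1) * X g \<le> (l - 1) * (Y g + Z g)"
      using XY[of g] Z0[of g] l1 by (intro mult_left_mono) auto
    \<comment> \<open>Multiplying \<open>q g \<le> 128\<close> by \<open>w g\<close> gives
      \<open>1 \<le> 128 * w g\<close>.\<close>
    moreover have "1 * \<bar>f (scale_vec n l g)\<bar> \<le> (128 * w g) * \<bar>f (scale_vec n l g)\<bar>"
      using mult_left_mono[OF True w0[of g]] wq[of g] by (intro mult_right_mono) auto
    ultimately show ?thesis by linarith
  next
    case False
    \<comment> \<open>This trades \<open>N g\<close> for its square and a constant; the constant is
      then multiplied by \<open>q g / 128 > 1\<close>. Both resulting terms have explicit means, so
      no integral over the exceptional set is required.\<close>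
    have "0 \<le> (N g - 4 * sqrt n)\<^sup>2" by simp
    then have "8 * sqrt n * N g \<le> (N g)\<^sup>2 + 16 * real n"
      by (simp add: power2_diff power_mult_distrib algebra_simps)
    then have "N g \<le> ((N g)\<^sup>2 + 16 * real n) / (8 * sqrt n)"
      using sn(1) by (subst pos_le_divide_eq) (simp_all add: mult.commute)
    also have "\<dots> = (N g)\<^sup>2 / (8 * sqrt n) + 2 * (real n / sqrt n)"
      by (simp add: add_divide_distrib)
    also have "real n / sqrt n = sqrt n" by (simp add: real_div_sqrt)
    finally have "N g \<le> (N g)\<^sup>2 / (8 * sqrt n) + 2 * sqrt n * 1" by simp
    also have "\<dots> \<le> (N g)\<^sup>2 / (8 * sqrt n) + 2 * sqrt n * (q g / 128)"
      using False by (intro add_left_mono mult_left_mono) auto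
    finally have "r * N g \<le> Z g" unfolding Z_def using r by (intro mult_left_mono) auto
    then have "(l - 1) * (r * N g) \<le> (l - 1) * (Y g + Z g)"
      using Y0[of g] l1 by (intro mult_left_mono) auto
    then show ?thesis using w0[of g] by (smt (verit) mult_nonneg_nonneg abs_ge_zero)
  qed

  have EN: "has_bochner_integral (gauss n) (\<lambda>g. r * N g) 1"
    using gauss_norm[of n] n r unfolding has_bochner_integral_iff by (simp add: N_def)
  have EF: "has_bochner_integral (gauss n) (\<lambda>g. \<bar>f g\<bar>) (\<integral>g. \<bar>f g\<bar> \<partial>gauss n)"
    using F by (simp add: has_bochner_integral_iff f_def)
  have EFs: "has_bochner_integral (gauss n) (\<lambda>g. w g * \<bar>f (scale_vec n l g)\<bar>) (\<integral>g. \<bar>f g\<bar> \<partial>gauss n)"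
    unfolding w_def using l1 F by (intro gauss_integral_scaling) (auto simp: f_def)
  have EY: "has_bochner_integral (gauss n) Y ((m - 1 + (\<Sum>s\<in>S. exp (\<theta>\<^sup>2 * r\<^sup>2 / 2) * exp (- m))) / \<theta>)"
  proof -
    have "has_bochner_integral (gauss n) (\<lambda>g. exp (\<theta> * dot n g s)) (exp (\<theta>\<^sup>2 * r\<^sup>2 / 2))" if "s \<in> S" for s
      using gauss_dot_mgf[of n \<theta> s] that S by (auto simp: centered_sphere_def)
    moreover have "has_bochner_integral (gauss n) (\<lambda>_. m - 1) (m - 1)"
      by (simp add: has_bochner_integral_iff gauss.prob_space)
    ultimately show ?thesis
      unfolding Y_def[abs_def] using \<theta>
      by (intro has_bochner_integral_divide has_bochner_integral_add has_bochner_integral_sum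
          has_bochner_integral_mult_left) auto
  qed
  define Q where "Q = (1 / sqrt (1 - u)) ^ n / l ^ n"
  have EZ: "has_bochner_integral (gauss n) Z (r * (real n / (8 * sqrt n) + 2 * sqrt n * (Q / 128)))"
    unfolding Z_def[abs_def] q_def Q_def N_def using u
    by (intro has_bochner_integral_mult_right has_bochner_integral_add has_bochner_integral_divide
        gauss_norm_square gauss_exp_norm_square) auto

  have Q: "Q \<le> 4"
  proof -
    have "Q = (1 / sqrt ((1 - u) * (1 + u))) ^ n"
      by (simp add: Q_def l_def real_sqrt_mult power_divide power_mult_distrib)
    also have "(1 - u) * (1 + u) = 1 - 1 / n"
      using u(3) by (simp add: power2_eq_square algebra_simps)
    finally have Q: "Q = 1 / sqrt (1 - 1 / n) ^ n" by (simp add: power_divide)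
    \<comment> \<open>The coefficient \<open>3 / 4\<close> exceeds \<open>1 / 2\<close>, which
      absorbs the quadratic term, and lies below 1, so that Bernoulli's inequality leaves the
      positive bound \<open>1 / 4\<close>.\<close>
    have "(1 - 3 / (4 * real n))\<^sup>2 \<le> 1 - 1 / n"
      using n by (simp add: power2_eq_square field_simps)
    then have "1 - 3 / (4 * real n) \<le> sqrt (1 - 1 / n)" by (rule real_le_rsqrt)
    then have "(1 - 3 / (4 * real n)) ^ n \<le> sqrt (1 - 1 / n) ^ n"
      using n by (intro power_mono) (auto simp: field_simps)
    moreover have "1 + real n * (- (3 / (4 * real n))) \<le> (1 + - (3 / (4 * real n))) ^ n"
      using n by (intro Bernoulli_inequality) (auto simp: field_simps)
    moreover have "1 + real n * (- (3 / (4 * real n))) = 1 / 4" using n by simp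
    ultimately have "1 / 4 \<le> sqrt (1 - 1 / n) ^ n" by (simp only: add_uminus_conv_diff)
    then have "1 / sqrt (1 - 1 / n) ^ n \<le> 1 / (1 / 4)" by (intro divide_left_mono) auto
    then show ?thesis using Q by simp
  qed
  have rn: "r * sqrt n \<le> 3 / 2"
  proof -
    have "2 / 3 \<le> sqrt (2 / pi)"
      using pi_less_4 by (intro real_le_rsqrt) (simp add: power2_eq_square field_simps)
    then have "r * (2 / 3 * sqrt n) \<le> r * (sqrt (2 / pi) * sqrt n)"
      using r sn by (intro mult_left_mono mult_right_mono) auto
    also have "\<dots> \<le> r * (\<integral>g. L2_set g {..<n} \<partial>gauss n)"
      using r n gauss_norm_lower[of n] by (intro mult_left_mono) auto
    finally show ?thesis using r by simp
  qed
  have Yb: "(m - 1 + (\<Sum>s\<in>S. exp (\<theta>\<^sup>2 * r\<^sup>2 / 2) * exp (- m))) / \<theta> \<le> 1 / 4"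
  proof -
    have "(\<Sum>s\<in>S. exp (\<theta>\<^sup>2 * r\<^sup>2 / 2) * exp (- m)) = real (card S) * exp (- (real n / 72))"
      by (simp add: m_def exp_add[symmetric])
    also have "\<dots> \<le> exp (real n / 72) * exp (- (real n / 72))"
      using S by (intro mult_right_mono) auto
    also have "\<dots> = 1" by (simp add: exp_add[symmetric])
    finally have "(m - 1 + (\<Sum>s\<in>S. exp (\<theta>\<^sup>2 * r\<^sup>2 / 2) * exp (- m))) / \<theta> \<le> m / \<theta>"
      using \<theta> by (intro divide_right_mono) auto
    \<comment> \<open>The Gaussian exponent and the logarithm of the allowed cardinality contribute
      at most \<open>1 / 8\<close> each.\<close>
    also have "m / \<theta> = (r * sqrt n)\<^sup>2 / 18 + 1 / 8"
      using n by (simp add: m_def \<theta>_def power_mult_distrib power2_eq_square field_simps)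
    also have "\<dots> \<le> (3 / 2)\<^sup>2 / 18 + 1 / 8"
      using rn r sn by (intro add_right_mono divide_right_mono power_mono) auto
    finally show ?thesis by (simp add: power2_eq_square)
  qed
  have Zb: "r * (real n / (8 * sqrt n) + 2 * sqrt n * (Q / 128)) \<le> 9 / 32"
  proof -
    have "real n / (8 * sqrt n) = sqrt n / 8" using sn by (simp add: field_simps)
    moreover have "2 * sqrt n * (Q / 128) \<le> 2 * sqrt n * (4 / 128)"
      using Q by (intro mult_left_mono divide_right_mono) auto
    ultimately have "real n / (8 * sqrt n) + 2 * sqrt n * (Q / 128) \<le> 3 / 16 * sqrt n" by simp
    then have "r * (real n / (8 * sqrt n) + 2 * sqrt n * (Q / 128)) \<le> r * (3 / 16 * sqrt n)"
      using r by (intro mult_left_mono) auto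
    then show ?thesis using rn by simp
  qed

  let ?y = "(m - 1 + (\<Sum>s\<in>S. exp (\<theta>\<^sup>2 * r\<^sup>2 / 2) * exp (- m))) / \<theta>"
  let ?z = "r * (real n / (8 * sqrt n) + 2 * sqrt n * (Q / 128))"
  let ?f = "\<integral>g. \<bar>f g\<bar> \<partial>gauss n"
  have L: "has_bochner_integral (gauss n) (\<lambda>g. (l - 1) * (r * N g)) ((l - 1) * 1)"
    by (intro has_bochner_integral_mult_right EN)
  have R: "has_bochner_integral (gauss n)
      (\<lambda>g. 128 * (w g * \<bar>f (scale_vec n l g)\<bar>) + \<bar>f g\<bar> + (l - 1) * (Y g + Z g))
      (128 * ?f + ?f + (l - 1) * (?y + ?z))"
    by (intro has_bochner_integral_mult_right has_bochner_integral_add EF EFs EY EZ)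
  \<comment> \<open>The integral of \<open>key\<close>. Below, \<open>17 / 32\<close> is the sum of
    the bounds \<open>1 / 4\<close> for \<open>Y\<close> and \<open>9 / 32\<close> for
    \<open>Z\<close>.\<close>
  have "(l - 1) * 1 \<le> 128 * ?f + ?f + (l - 1) * (?y + ?z)"
    using integral_mono[OF integrable.intros[OF L] integrable.intros[OF R] key]
    unfolding has_bochner_integral_integral_eq[OF L] has_bochner_integral_integral_eq[OF R] .
  also have "\<dots> \<le> 129 * \<epsilon> + (l - 1) * (17 / 32)"
  proof (rule add_mono)
    show "128 * ?f + ?f \<le> 129 * \<epsilon>" using F(2) by (simp add: f_def)
    have "?y + ?z \<le> 17 / 32" using Yb Zb by linarith
    then show "(l - 1) * (?y + ?z) \<le> (l - 1) * (17 / 32)" using l1 by (intro mult_left_mono) auto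
  qed
  finally have "15 / 32 * (l - 1) \<le> 129 * \<epsilon>" by (simp add: field_simps)
  then have "5 / 32 * u \<le> 129 * \<epsilon>" using ul by linarith
  then have "5 / 32 * u * sqrt n \<le> 129 * \<epsilon> * sqrt n" by (intro mult_right_mono) auto
  then show ?thesis using sn by (simp add: u_def)
qed

section \<open>Choice of the dimension and the constants\<close>

theorem mainTheorem9:
  shows "\<exists>\<epsilon>\<^sub>0 c a b :: real. 0 < \<epsilon>\<^sub>0 \<and> 0 < c \<and> 0 < a \<and> a \<le> b \<and>
    (\<forall>\<epsilon>::real. 0 < \<epsilon> \<and> \<epsilon> < \<epsilon>\<^sub>0 \<longrightarrow>
      (\<exists>n::nat. a / \<epsilon>\<^sup>2 \<le> real n \<and> real n \<le> b / \<epsilon>\<^sup>2 \<and>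
        (\<forall>r T. 0 < r \<and> T = centered_sphere n r \<and> gaussian_width n T = 1 \<longrightarrow>
          (\<forall>(S :: (nat \<Rightarrow> real) set) (cs :: (nat \<Rightarrow> real) \<Rightarrow> real).
            S \<subseteq> T \<and> finite S \<and> S \<noteq> {} \<and>
            gauss_L1 n (\<lambda>g. (SUP t\<in>T. dot n g t) - Max ((\<lambda>s. dot n g s + cs s) ` S)) \<le> ennreal \<epsilon>
            \<longrightarrow> real (card S) \<ge> exp (c / \<epsilon>\<^sup>2)))))"
proof (rule exI[of _ "1 / 10 ^ 4"], rule exI[of _ "1 / (144 * 10 ^ 6)"], rule exI[of _ "1 / (2 * 10 ^ 6)"],
    rule exI[of _ "1 / 10 ^ 6"], intro conjI allI impI)
  fix \<epsilon> :: real
  assume \<epsilon>: "0 < \<epsilon> \<and> \<epsilon> < 1 / 10 ^ 4"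
  \<comment> \<open>This scale gives \<open>129 * \<epsilon> * sqrt n \<le> 129 / 1000\<close>,
    which is below \<open>5 / 32\<close>. The bound on \<epsilon> makes \<open>B > 100\<close>, so
    rounding down keeps \<open>n \<ge> 72\<close> and loses at most a factor 2: hence the ratio 2 of
    the two dimension constants, and \<open>144 = 2 * 72\<close> in the exponent.\<close>
  define B where "B = 1 / 10 ^ 6 / \<epsilon>\<^sup>2"
  define n where "n = nat \<lfloor>B\<rfloor>"
  have "\<epsilon>\<^sup>2 < (1 / 10 ^ 4)\<^sup>2" using \<epsilon> by (intro power_strict_mono) auto
  then have B: "B > 100" using \<epsilon> by (simp add: B_def field_simps)
  have nB: "real n \<le> B" "B - 1 < real n" using B by (auto simp: n_def)
  have n: "72 \<le> n" "B / 2 \<le> real n" using nB B by auto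
  show "\<exists>n::nat. 1 / (2 * 10 ^ 6) / \<epsilon>\<^sup>2 \<le> real n \<and> real n \<le> 1 / 10 ^ 6 / \<epsilon>\<^sup>2 \<and>
        (\<forall>r T. 0 < r \<and> T = centered_sphere n r \<and> gaussian_width n T = 1 \<longrightarrow>
          (\<forall>(S :: (nat \<Rightarrow> real) set) (cs :: (nat \<Rightarrow> real) \<Rightarrow> real).
            S \<subseteq> T \<and> finite S \<and> S \<noteq> {} \<and>
            gauss_L1 n (\<lambda>g. (SUP t\<in>T. dot n g t) - Max ((\<lambda>s. dot n g s + cs s) ` S)) \<le> ennreal \<epsilon>
            \<longrightarrow> real (card S) \<ge> exp (1 / (144 * 10 ^ 6) / \<epsilon>\<^sup>2)))"
  proof (intro exI[of _ n] conjI allI impI)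
    show "1 / (2 * 10 ^ 6) / \<epsilon>\<^sup>2 \<le> real n" "real n \<le> 1 / 10 ^ 6 / \<epsilon>\<^sup>2"
      using n nB by (simp_all add: B_def)
  next
    fix r T and S :: "(nat \<Rightarrow> real) set" and cs :: "(nat \<Rightarrow> real) \<Rightarrow> real"
    assume T: "0 < r \<and> T = centered_sphere n r \<and> gaussian_width n T = 1"
      and S: "S \<subseteq> T \<and> finite S \<and> S \<noteq> {} \<and>
        gauss_L1 n (\<lambda>g. (SUP t\<in>T. dot n g t) - Max ((\<lambda>s. dot n g s + cs s) ` S)) \<le> ennreal \<epsilon>"
    have SUP: "(SUP t\<in>T. dot n g t) = r * L2_set g {..<n}" for g
      using T n by (simp add: SUP_centered_sphere)
    have w: "r * (\<integral>g. L2_set g {..<n} \<partial>gauss n) = 1"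
      using T by (simp add: gaussian_width_def SUP)
    let ?F = "\<lambda>g. r * L2_set g {..<n} - Max ((\<lambda>s. dot n g s + cs s) ` S)"
    have [measurable]: "?F \<in> borel_measurable (gauss n)"
      using S by (intro borel_measurable_diff borel_measurable_times borel_measurable_Max
          borel_measurable_add measurable_L2_gauss measurable_dot_gauss borel_measurable_const) auto
    have fin: "(\<integral>\<^sup>+g. ennreal \<bar>?F g\<bar> \<partial>gauss n) \<le> ennreal \<epsilon>"
      using S by (simp add: gauss_L1_def SUP)
    \<comment> \<open>The extended-valued norm is finite, so integrability follows and the norm
      becomes an ordinary integral.\<close>
    then have int: "integrable (gauss n) ?F"
      by (intro integrableI_bounded) (auto simp: le_less_trans[OF _ ennreal_less_top])
    have "(\<integral>g. \<bar>?F g\<bar> \<partial>gauss n) \<le> \<epsilon>"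
      using fin \<epsilon> int by (subst (asm) nn_integral_eq_integral) auto
    show "real (card S) \<ge> exp (1 / (144 * 10 ^ 6) / \<epsilon>\<^sup>2)"
    proof (rule ccontr)
      assume "\<not> ?thesis"
      moreover have "1 / (144 * 10 ^ 6) / \<epsilon>\<^sup>2 \<le> real n / 72" using n(2) by (simp add: B_def)
      ultimately have "real (card S) \<le> exp (real n / 72)"
        by (meson exp_le_cancel_iff less_imp_le not_le order_trans)
      then have *: "5 / 32 \<le> 129 * \<epsilon> * sqrt n"
        using T S w n int \<open>(\<integral>g. \<bar>?F g\<bar> \<partial>gauss n) \<le> \<epsilon>\<close> by (intro sphere_approximation_bound) auto
      have "sqrt n \<le> sqrt B" using nB by simp
      also have "\<dots> = 1 / 1000 / \<epsilon>"
        using \<epsilon> by (intro real_sqrt_unique) (auto simp: B_def power_divide power2_eq_square)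
      finally have "\<epsilon> * sqrt n \<le> \<epsilon> * (1 / 1000 / \<epsilon>)" using \<epsilon> by (intro mult_left_mono) auto
      then show False using * \<epsilon> by simp
    qed
  qed
qed (auto simp: field_simps)

end
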